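(* Let $n$ be fixed, let $\{P_{n,\alpha,\beta}:\alpha\in A,\beta\in B\}$ be a family of probability measures, let $\alpha_0\in A$, let $T_n(\alpha_0)$ be a real-valued test statistic, and let $0<\delta<1$. For each $\beta\in B$ let $c_{n,\beta}(\delta)\in\mathbb{R}$ satisfy $P_{n,\alpha_0,\beta}(T_n(\alpha_0)>c_{n,\beta}(\delta))=\delta$ (such numbers being assumed to exist), and let $c_{n,\sup}(\delta)=\sup_{\beta\in B}c_{n,\beta}(\delta)$. Let $\hat\beta_n$ be an estimator of $\beta$ with values in $B$ such that $c_{n,\hat\beta_n}(\delta)$ is measurable. Suppose that there exists $\beta_n^{\max}=\beta_n^{\max}(\delta)\in B$ such that $c_{n,\beta_n^{\max}}(\delta)=c_{n,\sup}(\delta)$. (a) If $$P_{n,\alpha_0,\beta_n^{\max}}\left(c_{n,\hat\beta_n}(\delta)<T_n(\alpha_0)\le c_{n,\sup}(\delta)\right)>0,$$ then $$\sup_{\beta\in B}P_{n,\alpha_0,\beta}\left(T_n(\alpha_0)>c_{n,\hat\beta_n}(\delta)\right)>\delta,$$ i.e., the test that rejects $H_0:\alpha=\alpha_0$ when $T_n(\alpha_0)>c_{n,\hat\beta_n}(\delta)$ does not have level $\delta$. (b) More generally, let $\hat c_n$ be any random critical value satisfying $\hat c_n\le c_{n,\beta_n^{\max}}(\delta)\,(=c_{n,\sup}(\delta))$ with $P_{n,\alpha_0,\beta_n^{\max}}$-probability $1$. If $$P_{n,\alpha_0,\beta_n^{\max}}\left(\hat c_n<T_n(\alpha_0)\le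 c_{n,\sup}(\delta)\right)>0,$$ then $$\sup_{\beta\in B}P_{n,\alpha_0,\beta}\left(T_n(\alpha_0)>\hat c_n\right)>\delta.$$ (c) The result in (b) continues to hold if the random critical value $\hat c_n$ also depends on some additional randomization mechanism.
   Context: For each fixed sample size $n$, all the measures $P_{n,\alpha,\beta}$ ($\alpha\in A$ the parameter of interest, $\beta\in B$ a nuisance parameter) live on a common measurable space (which may depend on $n$); $A$ and $B$ are arbitrary parameter sets. $T_n(\alpha_0)$ is a real-valued measurable function on that space. The number $c_{n,\beta}(\delta)$ is a $(1-\delta)$-quantile of $T_n(\alpha_0)$ under $P_{n,\alpha_0,\beta}$ in the stated sense; it need not be the smallest such number. A random critical value is a real-valued measurable function of the data. In the case of an additional randomization mechanism, the sample space is enlarged by taking the product with an auxiliary probability space carrying the randomization (so that the distribution of $T_n(\alpha_0)$ under each $P_{n,\alpha_0,\beta}$ is unchanged), $\hat c_n$ is a measurable function on the product space, and probabilities are taken under the product measures. *)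

theory Defs
  imports "HOL-Probability.Probability"
begin

text \<open>
  A nonrandomized test is given by its rejection rule. The null hypothesis is the family of
  distributions \<open>N \<beta>\<close> with nuisance parameter \<open>\<beta> \<in> B\<close>; level \<open>\<delta>\<close> is required uniformly over it.
\<close>

definition has_level :: "('b \<Rightarrow> 'x measure) \<Rightarrow> 'b set \<Rightarrow> ('x \<Rightarrow> bool) \<Rightarrow> real \<Rightarrow> bool" where
  "has_level N B reject \<delta> \<longleftrightarrow> (\<forall>\<beta>\<in>B. \<P>(x in N \<beta>. reject x) \<le> \<delta>)"

end

theory Submission
  imports Defs
begin

text \<open>
  Under the least favourable \<open>\<beta>_max\<close>, the random critical value lies almost surely below
  \<open>c \<beta>_max\<close>, so almost surely the event \<open>T > c_hat\<close> is the disjoint union of \<open>T > c \<beta>_max\<close>, which has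
  probability exactly \<open>\<delta>\<close>, and \<open>c_hat < T \<le> c \<beta>_max\<close>, which has positive probability. With
  randomization the same argument applies on the product space, where \<open>T\<close> keeps its distribution.
\<close>

lemma (in prob_space) prob_gt_random_critical_value:
  fixes S k :: "'a \<Rightarrow> real"
  assumes [measurable]: "S \<in> borel_measurable M" "k \<in> borel_measurable M"
    and le: "AE x in M. k x \<le> q"
    and pos: "\<P>(x in M. k x < S x \<and> S x \<le> q) > 0"
  shows "\<P>(x in M. S x > q) < \<P>(x in M. S x > k x)"
proof -
  have "\<P>(x in M. S x > q) < \<P>(x in M. S x > q) + \<P>(x in M. k x < S x \<and> S x \<le> q)"
    using pos by simp
  also have "\<dots> = prob ({x \<in> space M. S x > q} \<union> {x \<in> space M. k x < S x \<and> S x \<le> q})"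
    by (intro finite_measure_Union [symmetric]) auto
  \<comment> \<open>The inclusion holds only almost everywhere: \<open>S x > q\<close> yields
    \<open>S x > k x\<close> just where \<open>k x \<le> q\<close>, while the second event lies
    inside \<open>S x > k x\<close> outright.\<close>
  also have "\<dots> \<le> \<P>(x in M. S x > k x)"
    using le by (intro finite_measure_mono_AE) auto
  finally show ?thesis .
qed

text \<open>A real-valued \<open>SUP\<close> is an upper bound only for a set bounded above; here 1
  bounds all the probabilities. The measures \<open>N i\<close> are left general so that the lemma
  serves the original and the product spaces alike.\<close>

lemma less_SUP_prob:
  assumes "\<And>i. i \<in> I \<Longrightarrow> prob_space (N i)" "j \<in> I" "d < measure (N j) (E j)"
  shows "d < (SUP i\<in>I. measure (N i) (E i))"
proof -
  have "bdd_above ((\<lambda>i. measure (N i) (E i)) ` I)"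
    using assms(1) by (intro bdd_aboveI2 [where M = 1]) (simp add: prob_space.prob_le_1)
  then show ?thesis
    using assms(2,3) by (auto intro: less_le_trans cSUP_upper)
qed

text \<open>The event is a rectangle whose second side is the whole space of \<open>R\<close>, which
  contributes a factor 1. Hence independent randomization leaves the distribution of a statistic of
  the data unchanged.\<close>

lemma (in prob_space) prob_pair_measure_fst:
  assumes "prob_space R" "Measurable.pred M Q"
  shows "\<P>(z in M \<Otimes>\<^sub>M R. Q (fst z)) = \<P>(x in M. Q x)"
proof -
  interpret R: prob_space R by fact
  have "{z \<in> space (M \<Otimes>\<^sub>M R). Q (fst z)} = {x \<in> space M. Q x} \<times> space R"
    by (auto simp: space_pair_measure)
  then show ?thesis
    using assms(2) by (simp add: measure_def
      R.emeasure_pair_measure_Times R.emeasure_space_1)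
qed

theorem proposition1:
  fixes M :: "'x measure"
    and P :: "'a \<Rightarrow> 'b \<Rightarrow> 'x measure"
    and A :: "'a set" and B :: "'b set"
    and \<alpha>\<^sub>0 :: 'a
    and T :: "'a \<Rightarrow> 'x \<Rightarrow> real"
    and \<delta> :: real
    and c :: "'b \<Rightarrow> real"
    and c_sup :: ereal
    and \<beta>_hat :: "'x \<Rightarrow> 'b"
    and \<beta>_max :: 'b
  assumes prob: "\<And>\<alpha> \<beta>. \<alpha> \<in> A \<Longrightarrow> \<beta> \<in> B \<Longrightarrow> prob_space (P \<alpha> \<beta>)"
    and sets_P: "\<And>\<alpha> \<beta>. \<alpha> \<in> A \<Longrightarrow> \<beta> \<in> B \<Longrightarrow> sets (P \<alpha> \<beta>) = sets M"
    and \<alpha>\<^sub>0: "\<alpha>\<^sub>0 \<in> A"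
    and T: "T \<alpha>\<^sub>0 \<in> borel_measurable M"
    and \<delta>: "0 < \<delta>" "\<delta> < 1"
    and c: "\<And>\<beta>. \<beta> \<in> B \<Longrightarrow> \<P>(x in P \<alpha>\<^sub>0 \<beta>. T \<alpha>\<^sub>0 x > c \<beta>) = \<delta>"
    and c_sup: "c_sup = (SUP \<beta>\<in>B. ereal (c \<beta>))"
    and \<beta>_hat: "\<beta>_hat \<in> space M \<rightarrow> B"
    and c_\<beta>_hat: "(\<lambda>x. c (\<beta>_hat x)) \<in> borel_measurable M"
    and \<beta>_max: "\<beta>_max \<in> B" "ereal (c \<beta>_max) = c_sup"
  shows
    "(\<P>(x in P \<alpha>\<^sub>0 \<beta>_max. c (\<beta>_hat x) < T \<alpha>\<^sub>0 x \<and> ereal (T \<alpha>\<^sub>0 x) \<le> c_sup) > 0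
       \<longrightarrow> (SUP \<beta>\<in>B. \<P>(x in P \<alpha>\<^sub>0 \<beta>. T \<alpha>\<^sub>0 x > c (\<beta>_hat x))) > \<delta>
         \<and> \<not> has_level (P \<alpha>\<^sub>0) B (\<lambda>x. T \<alpha>\<^sub>0 x > c (\<beta>_hat x)) \<delta>)
   \<and> (\<forall>c_hat \<in> borel_measurable M.
       (AE x in P \<alpha>\<^sub>0 \<beta>_max. c_hat x \<le> c \<beta>_max)
       \<and> \<P>(x in P \<alpha>\<^sub>0 \<beta>_max. c_hat x < T \<alpha>\<^sub>0 x \<and> ereal (T \<alpha>\<^sub>0 x) \<le> c_sup) > 0
       \<longrightarrow> (SUP \<beta>\<in>B. \<P>(x in P \<alpha>\<^sub>0 \<beta>. T \<alpha>\<^sub>0 x > c_hat x)) > \<delta>)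
   \<and> (\<forall>R :: 'r measure. prob_space R \<longrightarrow>
       (\<forall>c_hat \<in> borel_measurable (M \<Otimes>\<^sub>M R).
         (AE z in P \<alpha>\<^sub>0 \<beta>_max \<Otimes>\<^sub>M R. c_hat z \<le> c \<beta>_max)
         \<and> \<P>(z in P \<alpha>\<^sub>0 \<beta>_max \<Otimes>\<^sub>M R. c_hat z < T \<alpha>\<^sub>0 (fst z) \<and> ereal (T \<alpha>\<^sub>0 (fst z)) \<le> c_sup) > 0
         \<longrightarrow> (SUP \<beta>\<in>B. \<P>(z in P \<alpha>\<^sub>0 \<beta> \<Otimes>\<^sub>M R. T \<alpha>\<^sub>0 (fst z) > c_hat z)) > \<delta>))"
proof -
  let ?Q = "P \<alpha>\<^sub>0"
  have prob0: "prob_space (?Q \<beta>)" if "\<beta> \<in> B" for \<beta>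
    using prob \<alpha>\<^sub>0 that by blast
  interpret Q: prob_space "?Q \<beta>_max" by (rule prob0 [OF \<beta>_max(1)])
  have sets_Q [measurable_cong]: "sets (?Q \<beta>_max) = sets M"
    using sets_P \<alpha>\<^sub>0 \<beta>_max(1) by blast
  have space_Q: "space (?Q \<beta>_max) = space M"
    by (rule sets_eq_imp_space_eq [OF sets_Q])
  note [measurable] = T
  have c_max: "\<P>(x in ?Q \<beta>_max. T \<alpha>\<^sub>0 x > c \<beta>_max) = \<delta>"
    by (rule c [OF \<beta>_max(1)])
  \<comment> \<open>As the supremum is attained at \<open>\<beta>_max\<close>, it is a real number,
    and comparisons in \<open>ereal\<close> reduce to comparisons with
    \<open>c \<beta>_max\<close>.\<close>
  have le_c_sup: "ereal t \<le> c_sup \<longleftrightarrow> t \<le> c \<beta>_max" for t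
    by (simp flip: \<beta>_max(2))
  have c_le: "c \<beta> \<le> c \<beta>_max" if "\<beta> \<in> B" for \<beta>
    unfolding le_c_sup [symmetric] c_sup using that by (rule SUP_upper)
  have nonrandomized: "\<delta> < \<P>(x in ?Q \<beta>_max. T \<alpha>\<^sub>0 x > k x)"
    if [measurable]: "k \<in> borel_measurable M" and "AE x in ?Q \<beta>_max. k x \<le> c \<beta>_max"
      and "\<P>(x in ?Q \<beta>_max. k x < T \<alpha>\<^sub>0 x \<and> ereal (T \<alpha>\<^sub>0 x) \<le> c_sup) > 0" for k
    using Q.prob_gt_random_critical_value [of "T \<alpha>\<^sub>0" k "c \<beta>_max"] that(2,3)
    by (simp add: c_max le_c_sup)
  have randomized: "\<delta> < \<P>(z in ?Q \<beta>_max \<Otimes>\<^sub>M R. T \<alpha>\<^sub>0 (fst z) > k z)"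
    if "prob_space R" and [measurable]: "k \<in> borel_measurable (M \<Otimes>\<^sub>M R)"
      and "AE z in ?Q \<beta>_max \<Otimes>\<^sub>M R. k z \<le> c \<beta>_max"
      and "\<P>(z in ?Q \<beta>_max \<Otimes>\<^sub>M R. k z < T \<alpha>\<^sub>0 (fst z) \<and> ereal (T \<alpha>\<^sub>0 (fst z)) \<le> c_sup) > 0"
    for R :: "'r measure" and k
  proof -
    interpret R: prob_space R by fact
    interpret QR: pair_prob_space "?Q \<beta>_max" R ..
    \<comment> \<open>The threshold \<open>c \<beta>_max\<close> keeps its exact rejection
      probability on the product space, so the general lemma again compares with \<delta>.\<close>
    have "\<P>(z in ?Q \<beta>_max \<Otimes>\<^sub>M R. T \<alpha>\<^sub>0 (fst z) > c \<beta>_max) = \<delta>"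
      using Q.prob_pair_measure_fst [OF that(1), of "\<lambda>x. T \<alpha>\<^sub>0 x > c \<beta>_max"] by (simp add: c_max)
    then show ?thesis
      using QR.prob_gt_random_critical_value [of "\<lambda>z. T \<alpha>\<^sub>0 (fst z)" k "c \<beta>_max"] that(3,4)
      by (simp add: le_c_sup)
  qed
  have prob_R: "prob_space (?Q \<beta> \<Otimes>\<^sub>M R)" if "prob_space R" "\<beta> \<in> B" for R :: "'r measure" and \<beta>
  proof -
    interpret Q': prob_space "?Q \<beta>" by (rule prob0 [OF that(2)])
    interpret R: prob_space R by fact
    interpret pair_prob_space "?Q \<beta>" R ..
    show ?thesis by unfold_locales
  qed
  \<comment> \<open>Since the estimator takes values in \<open>B\<close>, the plug-in critical value
    is bounded by \<open>c \<beta>_max\<close> at every sample point; part (a) thus becomes an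
    instance of part (b).\<close>
  have AE_\<beta>_hat: "AE x in ?Q \<beta>_max. c (\<beta>_hat x) \<le> c \<beta>_max"
    using \<beta>_hat by (intro AE_I2 c_le) (auto simp: space_Q)
  show ?thesis
    \<comment> \<open>In all three parts the index \<open>\<beta>_max\<close> pushes the supremum
      above \<delta>; in part (a) it is also the witness against \<open>has_level\<close>.\<close>
    using nonrandomized [OF c_\<beta>_hat AE_\<beta>_hat] nonrandomized randomized \<beta>_max(1)
    by (intro conjI ballI allI impI; (elim conjE)?)
      (auto simp: has_level_def not_le intro!: less_SUP_prob [OF prob0] less_SUP_prob [OF prob_R])
qed

end
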